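(* Let $\Theta$ be an $r\times s$ matrix with real entries. The following are equivalent: (1) the columns of $\Theta$ are linearly independent over $\mathbb{Q}$; (2) the homogeneous error map $\tilde{\varepsilon}(\Theta):{}^{\ast}\widetilde{\mathbb{Z}}^{s}(\Theta)\to{}^{\ast}\widetilde{\mathbb{R}}^{r}_{\varepsilon}(\Theta)$ is an isomorphism; (3) ${}^{\ast}\widetilde{\mathbb{Z}}^{s}(\Theta)$ contains no nonzero ${}^{\ast}\mathbb{Z}$-ideal in ${}^{\ast}\mathbb{Z}^{s}$, i.e. no nonzero subgroup of ${}^{\ast}\mathbb{Z}^{s}$ stable under multiplication by scalars in ${}^{\ast}\mathbb{Z}$.
   Context: Fix a non-principal ultrafilter on $\mathbb{N}$; ${}^{\ast}\mathbb{Z}\subset{}^{\ast}\mathbb{R}$ are the ultrapowers of $\mathbb{Z}$, $\mathbb{R}$ and ${}^{\ast}\mathbb{R}_{\varepsilon}$ is the group of infinitesimals. Elements of ${}^{\ast}\mathbb{Z}^{s}$ are regarded as column vectors. The homogeneous diophantine approximation group is $${}^{\ast}\widetilde{\mathbb{Z}}^{s}(\Theta)=\{{}^{\ast}\boldsymbol{n}\in{}^{\ast}\mathbb{Z}^{s}\mid\Theta\,{}^{\ast}\boldsymbol{n}\in{}^{\ast}\mathbb{R}_{\varepsilon}^{r}\},$$ the homogeneous error map is $\tilde{\varepsilon}(\Theta)({}^{\ast}\boldsymbol{n})=\Theta\,{}^{\ast}\boldsymbol{n}$, and ${}^{\ast}\widetilde{\mathbb{R}}^{r}_{\varepsilon}(\Theta)=\{\Theta\,{}^{\ast}\boldsymbol{n}\mid{}^{\ast}\boldsymbol{n}\in{}^{\ast}\widetilde{\mathbb{Z}}^{s}(\Theta)\}$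 is the group of homogeneous errors. *)

theory Defs
  imports "HOL-Analysis.Analysis" "HOL-Algebra.Module"
begin

definition nonprincipal_ultrafilter :: "'i filter \<Rightarrow> bool" where
  "nonprincipal_ultrafilter U \<longleftrightarrow>
     U \<noteq> bot \<and> (\<forall>P. eventually P U \<or> eventually (\<lambda>i. \<not> P i) U) \<and> (\<forall>i. U \<noteq> principal {i})"


section \<open>Ultrapowers of commutative rings\<close>

definition ultra_rel :: "nat filter \<Rightarrow> ((nat \<Rightarrow> 'a) \<times> (nat \<Rightarrow> 'a)) set" where
  "ultra_rel U = {(x, y). eventually (\<lambda>n. x n = y n) U}"

definition ultra_class :: "nat filter \<Rightarrow> (nat \<Rightarrow> 'a) \<Rightarrow> (nat \<Rightarrow> 'a) set" where
  "ultra_class U x = ultra_rel U `` {x}"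

text \<open>Operations on classes are written as unions over representatives, in the style of
  \<^theory>\<open>HOL.Equiv_Relations\<close>; all members of such a union are the same class.\<close>

definition ultrapower :: "nat filter \<Rightarrow> (nat \<Rightarrow> 'a::comm_ring_1) set ring" where
  "ultrapower U =
    \<lparr>carrier = UNIV // ultra_rel U,
     mult = (\<lambda>X Y. \<Union>x\<in>X. \<Union>y\<in>Y. ultra_class U (\<lambda>n. x n * y n)),
     one = ultra_class U (\<lambda>_. 1),
     zero = ultra_class U (\<lambda>_. 0),
     add = (\<lambda>X Y. \<Union>x\<in>X. \<Union>y\<in>Y. ultra_class U (\<lambda>n. x n + y n))\<rparr>"

abbreviation hyperint :: "nat filter \<Rightarrow> (nat \<Rightarrow> int) set ring" where
  "hyperint \<equiv> ultrapower"

abbreviation hyperreal :: "nat filter \<Rightarrow> (nat \<Rightarrow> real) set ring" where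
  "hyperreal \<equiv> ultrapower"

definition standard :: "nat filter \<Rightarrow> 'a \<Rightarrow> (nat \<Rightarrow> 'a) set" where
  "standard U a = ultra_class U (\<lambda>_. a)"

text \<open>The inclusion of the hyperintegers into the hyperreals.\<close>

definition hyperreal_of_hyperint :: "nat filter \<Rightarrow> (nat \<Rightarrow> int) set \<Rightarrow> (nat \<Rightarrow> real) set" where
  "hyperreal_of_hyperint U X = (\<Union>x\<in>X. ultra_class U (\<lambda>n. real_of_int (x n)))"

definition hyperreal_less :: "nat filter \<Rightarrow> (nat \<Rightarrow> real) set \<Rightarrow> (nat \<Rightarrow> real) set \<Rightarrow> bool" where
  "hyperreal_less U X Y \<longleftrightarrow> (\<exists>x\<in>X. \<exists>y\<in>Y. eventually (\<lambda>n. x n < y n) U)"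

definition infinitesimals :: "nat filter \<Rightarrow> (nat \<Rightarrow> real) set set" where
  "infinitesimals U =
    {X \<in> carrier (hyperreal U).
       \<forall>e>0. hyperreal_less U (standard U (- e)) X \<and> hyperreal_less U X (standard U e)}"


section \<open>Column vectors over a ring\<close>

text \<open>The type of modules extends that of rings, so a multiplication and a unit have to be
  supplied; they are taken componentwise and play no role.\<close>

definition vec_module :: "('a, 'm) ring_scheme \<Rightarrow> ('a, 'a ^ 'n) module" where
  "vec_module R =
    \<lparr>carrier = {v. \<forall>i. v $ i \<in> carrier R},
     mult = (\<lambda>v w. \<chi> i. v $ i \<otimes>\<^bsub>R\<^esub> w $ i),
     one = (\<chi> i. \<one>\<^bsub>R\<^esub>),
     zero = (\<chi> i. \<zero>\<^bsub>R\<^esub>),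
     add = (\<lambda>v w. \<chi> i. v $ i \<oplus>\<^bsub>R\<^esub> w $ i),
     smult = (\<lambda>a v. \<chi> i. a \<otimes>\<^bsub>R\<^esub> v $ i)\<rparr>"


section \<open>Homogeneous diophantine approximation groups\<close>

definition homogeneous_error ::
    "nat filter \<Rightarrow> real ^ 's ^ 'r \<Rightarrow> (nat \<Rightarrow> int) set ^ 's \<Rightarrow> (nat \<Rightarrow> real) set ^ 'r" where
  "homogeneous_error U \<Theta> v =
    (\<chi> i. \<Oplus>\<^bsub>hyperreal U\<^esub>j\<in>UNIV.
        standard U (\<Theta> $ i $ j) \<otimes>\<^bsub>hyperreal U\<^esub> hyperreal_of_hyperint U (v $ j))"

definition dioph_approx :: "nat filter \<Rightarrow> real ^ 's ^ 'r \<Rightarrow> ((nat \<Rightarrow> int) set ^ 's) set" where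
  "dioph_approx U \<Theta> =
    {v \<in> carrier (vec_module (hyperint U)). \<forall>i. homogeneous_error U \<Theta> v $ i \<in> infinitesimals U}"

definition homogeneous_errors ::
    "nat filter \<Rightarrow> real ^ 's ^ 'r \<Rightarrow> ((nat \<Rightarrow> real) set ^ 'r) set" where
  "homogeneous_errors U \<Theta> = homogeneous_error U \<Theta> ` dioph_approx U \<Theta>"

definition dioph_approx_group ::
    "nat filter \<Rightarrow> real ^ 's ^ 'r \<Rightarrow> ((nat \<Rightarrow> int) set ^ 's) monoid" where
  "dioph_approx_group U \<Theta> =
    \<lparr>carrier = dioph_approx U \<Theta>,
     mult = add (vec_module (hyperint U)),
     one = zero (vec_module (hyperint U))\<rparr>"

definition homogeneous_error_group ::
    "nat filter \<Rightarrow> real ^ 's ^ 'r \<Rightarrow> ((nat \<Rightarrow> real) set ^ 'r) monoid" where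
  "homogeneous_error_group U \<Theta> =
    \<lparr>carrier = homogeneous_errors U \<Theta>,
     mult = add (vec_module (hyperreal U)),
     one = zero (vec_module (hyperreal U))\<rparr>"

text \<open>Linear independence of the columns as a family: repeated columns count as dependent,
  whence the injectivity requirement.\<close>

definition columns_rat_independent :: "real ^ 's ^ 'r \<Rightarrow> bool" where
  "columns_rat_independent \<Theta> \<longleftrightarrow>
     inj (\<lambda>j. column j \<Theta>) \<and>
     \<not> module.dependent (\<lambda>(q::rat) (v::real ^ 'r). of_rat q *\<^sub>R v) (columns \<Theta>)"

section \<open>Well-definedness\<close>

lemma equiv_ultra_rel: "equiv UNIV (ultra_rel U)"
proof (rule equivI)
  show "sym (ultra_rel U)"
    by (auto simp: sym_def ultra_rel_def elim: eventually_mono)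
  show "trans (ultra_rel U)"
    by (auto simp: trans_def ultra_rel_def elim: eventually_elim2)
qed (auto simp: refl_on_def ultra_rel_def)

lemma mem_ultra_class: "y \<in> ultra_class U x \<longleftrightarrow> eventually (\<lambda>n. x n = y n) U"
  by (simp add: ultra_class_def ultra_rel_def)

lemma ultra_class_eq_iff: "ultra_class U x = ultra_class U y \<longleftrightarrow> eventually (\<lambda>n. x n = y n) U"
  unfolding ultra_class_def using eq_equiv_class_iff[OF equiv_ultra_rel, of x y U]
  by (simp add: ultra_rel_def)

lemma self_mem_ultra_class: "x \<in> ultra_class U x"
  by (simp add: mem_ultra_class)

lemma ultra_class_nonempty: "ultra_class U x \<noteq> {}"
  using self_mem_ultra_class by blast

lemma UN_ultra_class:
  assumes "\<And>a. a \<in> ultra_class U x \<Longrightarrow> F a = C"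
  shows "(\<Union>a\<in>ultra_class U x. F a) = C"
  using assms self_mem_ultra_class[of x U] by blast

lemma carrier_ultrapower: "carrier (ultrapower U) = range (ultra_class U)"
  by (auto simp: ultrapower_def quotient_def ultra_class_def)

lemma ultra_class_closed: "ultra_class U x \<in> carrier (ultrapower U)"
  by (simp add: carrier_ultrapower)

lemma ultrapower_add:
  "ultra_class U x \<oplus>\<^bsub>ultrapower U\<^esub> ultra_class U y = ultra_class U (\<lambda>n. x n + y n)"
proof -
  have "ultra_class U (\<lambda>n. a n + b n) = ultra_class U (\<lambda>n. x n + y n)"
    if "a \<in> ultra_class U x" "b \<in> ultra_class U y" for a b
    using that unfolding mem_ultra_class ultra_class_eq_iff by eventually_elim auto
  then show ?thesis
    by (simp add: ultrapower_def UN_ultra_class ultra_class_nonempty)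
qed

lemma ultrapower_mult:
  "ultra_class U x \<otimes>\<^bsub>ultrapower U\<^esub> ultra_class U y = ultra_class U (\<lambda>n. x n * y n)"
proof -
  have "ultra_class U (\<lambda>n. a n * b n) = ultra_class U (\<lambda>n. x n * y n)"
    if "a \<in> ultra_class U x" "b \<in> ultra_class U y" for a b
    using that unfolding mem_ultra_class ultra_class_eq_iff by eventually_elim auto
  then show ?thesis
    by (simp add: ultrapower_def UN_ultra_class ultra_class_nonempty)
qed

lemma ultrapower_zero: "\<zero>\<^bsub>ultrapower U\<^esub> = ultra_class U (\<lambda>_. 0)"
  by (simp add: ultrapower_def)

lemma ultrapower_one: "\<one>\<^bsub>ultrapower U\<^esub> = ultra_class U (\<lambda>_. 1)"
  by (simp add: ultrapower_def)

lemmas ultrapower_ops = ultrapower_add ultrapower_mult ultrapower_zero ultrapower_one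

lemma cring_ultrapower: "cring (ultrapower U)"
proof (rule cringI)
  have inv: "ultra_class U (\<lambda>n. - x n) \<oplus>\<^bsub>ultrapower U\<^esub> ultra_class U x = \<zero>\<^bsub>ultrapower U\<^esub>"
    for x :: "nat \<Rightarrow> 'a"
    by (simp add: ultrapower_ops)
  show "abelian_group (ultrapower U :: (nat \<Rightarrow> 'a) set ring)"
  proof (rule abelian_groupI)
    fix X :: "(nat \<Rightarrow> 'a) set" assume "X \<in> carrier (ultrapower U)"
    then obtain x where "X = ultra_class U x" by (auto simp: carrier_ultrapower)
    then show "\<exists>Y\<in>carrier (ultrapower U). Y \<oplus>\<^bsub>ultrapower U\<^esub> X = \<zero>\<^bsub>ultrapower U\<^esub>"
      using inv[of x] ultra_class_closed by blast
  qed (auto simp: carrier_ultrapower ultrapower_ops add_ac)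
  show "comm_monoid (ultrapower U :: (nat \<Rightarrow> 'a) set ring)"
    by (rule comm_monoidI) (auto simp: carrier_ultrapower ultrapower_ops mult_ac)
qed (auto simp: carrier_ultrapower ultrapower_ops distrib_right)

lemma module_vec_module:
  assumes "cring R"
  shows "module R (vec_module R :: ('a, 'a ^ 'n) module)"
proof -
  interpret cring R by fact
  show ?thesis
  proof (rule moduleI)
    show "abelian_group (vec_module R :: ('a, 'a ^ 'n) module)"
    proof (rule abelian_groupI)
      fix v :: "'a ^ 'n" assume v: "v \<in> carrier (vec_module R)"
      show "\<exists>w\<in>carrier (vec_module R). w \<oplus>\<^bsub>vec_module R\<^esub> v = \<zero>\<^bsub>vec_module R\<^esub>"
        by (rule bexI[of _ "\<chi> i. \<ominus>\<^bsub>R\<^esub> (v $ i)"])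
          (use v in \<open>auto simp: vec_module_def vec_eq_iff l_neg\<close>)
    qed (auto simp: vec_module_def vec_eq_iff a_ac)
  qed (auto simp: vec_module_def vec_eq_iff l_distr r_distr m_assoc \<open>cring R\<close>)
qed

lemma hyperreal_of_hyperint_class:
  "hyperreal_of_hyperint U (ultra_class U x) = ultra_class U (\<lambda>n. real_of_int (x n))"
proof -
  have "ultra_class U (\<lambda>n. real_of_int (a n)) = ultra_class U (\<lambda>n. real_of_int (x n))"
    if "a \<in> ultra_class U x" for a
    using that unfolding mem_ultra_class ultra_class_eq_iff by eventually_elim auto
  then show ?thesis
    by (simp add: hyperreal_of_hyperint_def UN_ultra_class ultra_class_nonempty)
qed

lemma hyperreal_less_class:
  "hyperreal_less U (ultra_class U x) (ultra_class U y) \<longleftrightarrow> eventually (\<lambda>n. x n < y n) U"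
proof
  assume "hyperreal_less U (ultra_class U x) (ultra_class U y)"
  then obtain a b where "eventually (\<lambda>n. x n = a n) U" "eventually (\<lambda>n. y n = b n) U"
    "eventually (\<lambda>n. a n < b n) U"
    by (auto simp: hyperreal_less_def mem_ultra_class)
  then show "eventually (\<lambda>n. x n < y n) U" by eventually_elim simp
qed (auto simp: hyperreal_less_def intro: self_mem_ultra_class)

lemma ultra_class_infinitesimal_iff:
  "ultra_class U x \<in> infinitesimals U \<longleftrightarrow> (x \<longlongrightarrow> 0) U"
proof -
  have "ultra_class U x \<in> infinitesimals U \<longleftrightarrow>
      (\<forall>e>0. eventually (\<lambda>n. - e < x n \<and> x n < e) U)"
    by (simp add: infinitesimals_def standard_def ultra_class_closed hyperreal_less_class
        eventually_conj_iff)
  also have "\<dots> \<longleftrightarrow> (x \<longlongrightarrow> 0) U"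
    by (simp add: tendsto_iff dist_real_def abs_less_iff minus_less_iff conj_commute)
  finally show ?thesis .
qed

lemma finsum_ultra_class:
  assumes "finite J"
  shows "(\<Oplus>\<^bsub>ultrapower U\<^esub>j\<in>J. ultra_class U (x j)) = ultra_class U (\<lambda>n. \<Sum>j\<in>J. x j n)"
proof -
  interpret cring "ultrapower U :: (nat \<Rightarrow> 'b) set ring" by (rule cring_ultrapower)
  show ?thesis using assms
    by (induction J) (simp_all add: ultrapower_ops ultra_class_closed)
qed

lemma homogeneous_error_class:
  "homogeneous_error U \<Theta> (\<chi> j. ultra_class U (x j)) =
    (\<chi> i. ultra_class U (\<lambda>n. \<Sum>j\<in>UNIV. \<Theta> $ i $ j * real_of_int (x j n)))"
  by (simp add: homogeneous_error_def standard_def hyperreal_of_hyperint_class ultrapower_mult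
      finsum_ultra_class)

lemma hyper_vec_closed: "(\<chi> i. ultra_class U (x i)) \<in> carrier (vec_module (ultrapower U))"
  by (simp add: vec_module_def ultra_class_closed)

lemma hyper_vec_cases:
  assumes "v \<in> carrier (vec_module (ultrapower U))"
  obtains x where "v = (\<chi> i. ultra_class U (x i))"
proof -
  have "\<forall>i. \<exists>x. v $ i = ultra_class U x"
    using assms by (auto simp: vec_module_def carrier_ultrapower)
  then obtain x where "\<forall>i. v $ i = ultra_class U (x i)" by (rule choice[THEN exE])
  then show thesis by (intro that[of x]) (simp add: vec_eq_iff)
qed

lemma dioph_approx_class:
  "(\<chi> j. ultra_class U (x j)) \<in> dioph_approx U \<Theta> \<longleftrightarrow>
    (\<forall>i. ((\<lambda>n. \<Sum>j\<in>UNIV. \<Theta> $ i $ j * real_of_int (x j n)) \<longlongrightarrow> 0) U)"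
  by (simp add: dioph_approx_def homogeneous_error_class ultra_class_infinitesimal_iff
      hyper_vec_closed)

lemma dioph_approx_cases:
  assumes "v \<in> dioph_approx U \<Theta>"
  obtains x where "v = (\<chi> j. ultra_class U (x j))"
    "\<And>i. ((\<lambda>n. \<Sum>j\<in>UNIV. \<Theta> $ i $ j * real_of_int (x j n)) \<longlongrightarrow> 0) U"
proof -
  from assms have "v \<in> carrier (vec_module (hyperint U))" by (simp add: dioph_approx_def)
  then obtain x where x: "v = (\<chi> j. ultra_class U (x j))" by (rule hyper_vec_cases)
  from that[OF x] assms show ?thesis unfolding x dioph_approx_class by blast
qed

lemma hyper_vec_add:
  "(\<chi> i. ultra_class U (x i)) \<oplus>\<^bsub>vec_module (ultrapower U)\<^esub> (\<chi> i. ultra_class U (y i)) =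
    (\<chi> i. ultra_class U (\<lambda>n. x i n + y i n))"
  by (simp add: vec_module_def ultrapower_add)

lemma hyper_vec_zero:
  "\<zero>\<^bsub>vec_module (ultrapower U)\<^esub> = (\<chi> i. ultra_class U (\<lambda>n. 0))"
  by (simp add: vec_module_def ultrapower_zero)

lemma homogeneous_error_add:
  assumes "v \<in> carrier (vec_module (hyperint U))" "w \<in> carrier (vec_module (hyperint U))"
  shows "homogeneous_error U \<Theta> (v \<oplus>\<^bsub>vec_module (hyperint U)\<^esub> w) =
    homogeneous_error U \<Theta> v \<oplus>\<^bsub>vec_module (hyperreal U)\<^esub> homogeneous_error U \<Theta> w"
proof -
  obtain x where "v = (\<chi> i. ultra_class U (x i))"
    using assms(1) by (rule hyper_vec_cases)
  moreover obtain y where "w = (\<chi> i. ultra_class U (y i))"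
    using assms(2) by (rule hyper_vec_cases)
  ultimately show ?thesis
    by (simp add: hyper_vec_add homogeneous_error_class distrib_left sum.distrib)
qed

lemma comm_group_dioph_approx_group: "comm_group (dioph_approx_group U \<Theta>)"
proof -
  let ?M = "vec_module (hyperint U)"
  interpret module "hyperint U" ?M by (rule module_vec_module) (rule cring_ultrapower)
  have sub: "v \<in> carrier ?M" if "v \<in> dioph_approx U \<Theta>" for v
    using that by (simp add: dioph_approx_def)
  have zero: "\<zero>\<^bsub>?M\<^esub> \<in> dioph_approx U \<Theta>"
    by (simp add: hyper_vec_zero dioph_approx_class)
  have plus: "v \<oplus>\<^bsub>?M\<^esub> w \<in> dioph_approx U \<Theta>"
    if v: "v \<in> dioph_approx U \<Theta>" and w: "w \<in> dioph_approx U \<Theta>" for v w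
  proof -
    obtain x where x: "v = (\<chi> j. ultra_class U (x j))"
      "\<And>i. ((\<lambda>n. \<Sum>j\<in>UNIV. \<Theta> $ i $ j * real_of_int (x j n)) \<longlongrightarrow> 0) U"
      using v by (rule dioph_approx_cases) blast
    obtain y where y: "w = (\<chi> j. ultra_class U (y j))"
      "\<And>i. ((\<lambda>n. \<Sum>j\<in>UNIV. \<Theta> $ i $ j * real_of_int (y j n)) \<longlongrightarrow> 0) U"
      using w by (rule dioph_approx_cases) blast
    show ?thesis
      using tendsto_add[OF x(2) y(2)]
      by (simp add: x(1) y(1) hyper_vec_add dioph_approx_class distrib_left sum.distrib)
  qed
  have minus: "\<exists>w\<in>dioph_approx U \<Theta>. v \<oplus>\<^bsub>?M\<^esub> w = \<zero>\<^bsub>?M\<^esub>" if v: "v \<in> dioph_approx U \<Theta>" for v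
  proof -
    obtain x where x: "v = (\<chi> j. ultra_class U (x j))"
      "\<And>i. ((\<lambda>n. \<Sum>j\<in>UNIV. \<Theta> $ i $ j * real_of_int (x j n)) \<longlongrightarrow> 0) U"
      using v by (rule dioph_approx_cases) blast
    have "(\<chi> j. ultra_class U (\<lambda>n. - x j n)) \<in> dioph_approx U \<Theta>"
      using tendsto_minus[OF x(2)] by (simp add: dioph_approx_class sum_negf)
    moreover have "v \<oplus>\<^bsub>?M\<^esub> (\<chi> j. ultra_class U (\<lambda>n. - x j n)) = \<zero>\<^bsub>?M\<^esub>"
      by (simp add: x(1) hyper_vec_add hyper_vec_zero)
    ultimately show ?thesis ..
  qed
  show ?thesis
    by (rule comm_groupI)
      (simp_all add: dioph_approx_group_def zero plus minus sub M.a_ac)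
qed

lemma homogeneous_error_hom:
  "homogeneous_error U \<Theta> \<in> hom (dioph_approx_group U \<Theta>) (homogeneous_error_group U \<Theta>)"
  by (auto simp: hom_def dioph_approx_group_def homogeneous_error_group_def homogeneous_errors_def
      dioph_approx_def intro!: homogeneous_error_add)

lemma comm_group_homogeneous_error_group: "comm_group (homogeneous_error_group U \<Theta>)"
proof -
  interpret comm_group "dioph_approx_group U \<Theta>" by (rule comm_group_dioph_approx_group)
  have zero: "homogeneous_error U \<Theta> \<one>\<^bsub>dioph_approx_group U \<Theta>\<^esub> = \<one>\<^bsub>homogeneous_error_group U \<Theta>\<^esub>"
    by (simp add: dioph_approx_group_def homogeneous_error_group_def hyper_vec_zero
        homogeneous_error_class)
  have "(homogeneous_error_group U \<Theta>)
        \<lparr>carrier := homogeneous_error U \<Theta> ` carrier (dioph_approx_group U \<Theta>),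
         one := homogeneous_error U \<Theta> \<one>\<^bsub>dioph_approx_group U \<Theta>\<^esub>\<rparr> =
      homogeneous_error_group U \<Theta>"
    unfolding zero by (simp add: homogeneous_error_group_def homogeneous_errors_def
        dioph_approx_group_def)
  from this hom_imp_img_comm_group[OF homogeneous_error_hom] show ?thesis by (rule subst)
qed

lemma columns_rat_independent_iff:
  "columns_rat_independent \<Theta> \<longleftrightarrow>
    (\<forall>q :: 's \<Rightarrow> rat. (\<Sum>j\<in>UNIV. of_rat (q j) *\<^sub>R column j \<Theta>) = 0 \<longrightarrow> (\<forall>j. q j = 0))"
  for \<Theta> :: "real ^ 's ^ 'r"
proof -
  interpret Q: vector_space "\<lambda>(q::rat) (v::real ^ 'r). of_rat q *\<^sub>R v"
    by unfold_locales (simp_all add: scaleR_add_right of_rat_add scaleR_add_left of_rat_mult)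
  let ?c = "\<lambda>j. column j \<Theta>"
  have cols: "columns \<Theta> = range ?c" by (auto simp: columns_def)
  have dep: "Q.dependent (columns \<Theta>) \<longleftrightarrow>
      (\<exists>u. (\<exists>v\<in>columns \<Theta>. u v \<noteq> 0) \<and> (\<Sum>v\<in>columns \<Theta>. of_rat (u v) *\<^sub>R v) = 0)"
    by (rule Q.dependent_finite) (simp add: cols)
  show ?thesis
  proof
    assume A: "columns_rat_independent \<Theta>"
    then have inj: "inj ?c" and ind: "\<not> Q.dependent (columns \<Theta>)"
      by (auto simp: columns_rat_independent_def)
    show "\<forall>q :: 's \<Rightarrow> rat. (\<Sum>j\<in>UNIV. of_rat (q j) *\<^sub>R ?c j) = 0 \<longrightarrow> (\<forall>j. q j = 0)"
    proof (intro allI impI)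
      fix q :: "'s \<Rightarrow> rat" and j
      assume "(\<Sum>j\<in>UNIV. of_rat (q j) *\<^sub>R ?c j) = 0"
      then have "(\<Sum>v\<in>columns \<Theta>. of_rat (q (inv_into UNIV ?c v)) *\<^sub>R v) = 0"
        by (simp add: cols sum.reindex[OF inj] inv_f_f[OF inj])
      moreover have "?c j \<in> columns \<Theta>" by (simp add: cols)
      ultimately have "q (inv_into UNIV ?c (?c j)) = 0"
        using ind[unfolded dep not_ex, rule_format, of "\<lambda>v. q (inv_into UNIV ?c v)"] by blast
      then show "q j = 0" by (simp add: inv_f_f[OF inj])
    qed
  next
    assume A: "\<forall>q :: 's \<Rightarrow> rat. (\<Sum>j\<in>UNIV. of_rat (q j) *\<^sub>R ?c j) = 0 \<longrightarrow> (\<forall>j. q j = 0)"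
    have inj: "inj ?c"
    proof (rule injI, rule ccontr)
      fix a b assume ab: "?c a = ?c b" "a \<noteq> b"
      let ?q = "\<lambda>j. if j = a then 1 else if j = b then - 1 else (0::rat)"
      have "(\<Sum>j\<in>UNIV. of_rat (?q j) *\<^sub>R ?c j) = (\<Sum>j\<in>{a, b}. of_rat (?q j) *\<^sub>R ?c j)"
        by (rule sum.mono_neutral_right) auto
      also have "\<dots> = 0" using ab by (simp add: of_rat_minus)
      finally have "?q a = 0" using A[rule_format, of ?q a] by blast
      then show False by simp
    qed
    have "\<not> Q.dependent (columns \<Theta>)"
    proof
      assume "Q.dependent (columns \<Theta>)"
      then obtain u j where "u (?c j) \<noteq> 0" "(\<Sum>v\<in>columns \<Theta>. of_rat (u v) *\<^sub>R v) = 0"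
        unfolding dep unfolding cols by auto
      moreover from this have "(\<Sum>j\<in>UNIV. of_rat (u (?c j)) *\<^sub>R ?c j) = 0"
        by (simp add: cols sum.reindex[OF inj])
      ultimately show False using A[rule_format, of "\<lambda>j. u (?c j)"] by blast
    qed
    with inj show "columns_rat_independent \<Theta>" by (simp add: columns_rat_independent_def)
  qed
qed

end

theory Submission
  imports Defs "HOL-Algebra.Coset"
begin

text \<open>
  All three conditions say that \<open>\<Theta>\<close> has no nonzero exact relation, that is, no nonzero
  hyperinteger vector \<open>v\<close> with \<open>\<Theta> v = 0\<close> on the nose.

  A standard exact relation is a vanishing integer combination of the columns, and after clearing
  denominators this is the same as a rational one (\<open>columns_rat_independent_iff_int\<close>). A relation
  between hyperintegers is a sequence of integer vectors of which almost all are standard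
  relations, so nonzero hyperinteger relations exist exactly when nonzero standard ones do
  (\<open>exact_relations_trivial_iff\<close>). This settles rational independence.

  The exact relations are the kernel of the error map, which is surjective onto the group of errors
  by definition; this settles the isomorphism condition. Finally, the exact relations form the
  largest submodule of the hyperinteger vectors inside the approximation group
  (\<open>exact_relations_submodule\<close>, \<open>submodule_imp_exact_relations\<close>): a nonzero infinitesimal error,
  multiplied by a large enough hyperinteger, stops being infinitesimal. So the approximation group
  contains a nonzero submodule exactly when there is a nonzero exact relation.
\<close>

section \<open>Integer relations between the columns of a real matrix\<close>

lemma common_denominator:
  fixes q :: "'a \<Rightarrow> rat"
  assumes "finite A"
  obtains d :: int where "d \<noteq> 0" "\<And>j. j \<in> A \<Longrightarrow> of_int d * q j \<in> \<int>"
proof -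
  have "\<exists>d::int. d \<noteq> 0 \<and> (\<forall>j\<in>A. of_int d * q j \<in> \<int>)"
    using assms
  proof (induction A)
    case empty
    show ?case by (intro exI[of _ 1]) simp
  next
    case (insert a A)
    then obtain d :: int where d: "d \<noteq> 0" "\<forall>j\<in>A. of_int d * q j \<in> \<int>" by blast
    obtain n m :: int where m: "m > 0" "q a = of_int n / of_int m"
      by (cases "q a") (auto simp: Fract_of_int_quotient)
    have "of_int (m * d) * q j = of_int m * (of_int d * q j)" for j by simp
    then have "of_int (m * d) * q j \<in> \<int>" if "j \<in> A" for j
      using d(2) that by (metis Ints_mult Ints_of_int)
    moreover have "of_int (m * d) * q a = of_int (n * d)" using m by simp
    then have "of_int (m * d) * q a \<in> \<int>" by (metis Ints_of_int)
    ultimately show ?case using d(1) m(1) by (intro exI[of _ "m * d"]) auto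
  qed
  with that show thesis by blast
qed

lemma sum_scaleR_column:
  fixes \<Theta> :: "real ^ 's ^ 'r"
  shows "(\<Sum>j\<in>UNIV. c j *\<^sub>R column j \<Theta>) = \<Theta> *v (\<chi> j. c j)"
  by (simp add: matrix_mult_sum scalar_mult_eq_scaleR)

lemma columns_rat_independent_iff_int:
  fixes \<Theta> :: "real ^ 's ^ 'r"
  shows "columns_rat_independent \<Theta> \<longleftrightarrow>
    (\<forall>k. \<Theta> *v (\<chi> j. real_of_int (k j)) = 0 \<longrightarrow> (\<forall>j. k j = 0))"
  unfolding columns_rat_independent_iff sum_scaleR_column
proof (intro iffI allI impI)
  fix k :: "'s \<Rightarrow> int" and j
  assume "\<forall>q. \<Theta> *v (\<chi> j. real_of_rat (q j)) = 0 \<longrightarrow> (\<forall>j. q j = 0)"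
    and "\<Theta> *v (\<chi> j. real_of_int (k j)) = 0"
  from this(1)[rule_format, of "\<lambda>j. of_int (k j)" j] this(2) show "k j = 0" by simp
next
  fix q :: "'s \<Rightarrow> rat" and j
  assume int: "\<forall>k. \<Theta> *v (\<chi> j. real_of_int (k j)) = 0 \<longrightarrow> (\<forall>j. k j = 0)"
    and q: "\<Theta> *v (\<chi> j. real_of_rat (q j)) = 0"
  obtain d :: int where d: "d \<noteq> 0" "\<And>j. of_int d * q j \<in> \<int>"
    using common_denominator[of UNIV q] by auto
  from d(2) have "\<forall>j. \<exists>z. of_int d * q j = of_int z" by (auto elim!: Ints_cases)
  then obtain k where k: "\<And>j. of_int d * q j = of_int (k j)" by metis
  have "real_of_int (k j) = of_int d * of_rat (q j)" for j
    using arg_cong[OF k[of j], of real_of_rat] by (simp add: of_rat_mult)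
  then have "(\<chi> j. real_of_int (k j)) = of_int d *\<^sub>R (\<chi> j. real_of_rat (q j))"
    by (simp add: vec_eq_iff)
  then have "\<Theta> *v (\<chi> j. real_of_int (k j)) = 0"
    using q by (simp add: matrix_vector_mult_scaleR)
  with int have "k j = 0" by blast
  with k[of j] d(1) show "q j = 0" by simp
qed

section \<open>Exact relations between hyperintegers\<close>

definition exact_relations ::
    "nat filter \<Rightarrow> real ^ 's ^ 'r \<Rightarrow> ((nat \<Rightarrow> int) set ^ 's) set" where
  "exact_relations U \<Theta> =
    {v \<in> carrier (vec_module (hyperint U)).
       homogeneous_error U \<Theta> v = \<zero>\<^bsub>vec_module (hyperreal U)\<^esub>}"

text \<open>The transfer principle for the equation \<open>\<Theta> v = 0\<close>; the finitely many rows allow the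
  exceptional sets of the single rows to be merged into one.\<close>

lemma exact_relations_class:
  "(\<chi> j. ultra_class U (x j)) \<in> exact_relations U \<Theta> \<longleftrightarrow>
    eventually (\<lambda>n. \<Theta> *v (\<chi> j. real_of_int (x j n)) = 0) U"
  by (auto simp: exact_relations_def hyper_vec_closed homogeneous_error_class hyper_vec_zero
      vec_eq_iff ultra_class_eq_iff matrix_vector_mult_def
      intro: eventually_all_finite elim: eventually_mono)

lemma hyper_vec_eq_zero_iff:
  fixes x :: "'s::finite \<Rightarrow> nat \<Rightarrow> 'a::comm_ring_1"
  shows "(\<chi> j. ultra_class U (x j)) = \<zero>\<^bsub>vec_module (ultrapower U)\<^esub> \<longleftrightarrow>
    eventually (\<lambda>n. \<forall>j. x j n = 0) U"
  by (auto simp: hyper_vec_zero vec_eq_iff ultra_class_eq_iff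
      intro: eventually_all_finite elim: eventually_mono)

lemma hyper_vec_smult:
  "ultra_class U a \<odot>\<^bsub>vec_module (ultrapower U)\<^esub> (\<chi> i. ultra_class U (x i)) =
    (\<chi> i. ultra_class U (\<lambda>n. a n * x i n))"
  by (simp add: vec_module_def ultrapower_mult)

lemma zero_in_exact_relations: "\<zero>\<^bsub>vec_module (hyperint U)\<^esub> \<in> exact_relations U \<Theta>"
  by (simp add: hyper_vec_zero exact_relations_class flip: zero_vec_def)

lemma exact_relations_subset_dioph_approx: "exact_relations U \<Theta> \<subseteq> dioph_approx U \<Theta>"
  by (auto simp: exact_relations_def dioph_approx_def hyper_vec_zero ultra_class_infinitesimal_iff)

text \<open>Constant sequences turn a standard relation into a hyperinteger one. Conversely, a
  hyperinteger relation is at almost every index a standard relation, hence trivial there.\<close>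

lemma exact_relations_trivial_iff:
  fixes \<Theta> :: "real ^ 's ^ 'r"
  assumes "U \<noteq> bot"
  shows "columns_rat_independent \<Theta> \<longleftrightarrow> exact_relations U \<Theta> = {\<zero>\<^bsub>vec_module (hyperint U)\<^esub>}"
proof
  assume ind: "columns_rat_independent \<Theta>"
  have "v = \<zero>\<^bsub>vec_module (hyperint U)\<^esub>" if v: "v \<in> exact_relations U \<Theta>" for v
  proof -
    from v have "v \<in> carrier (vec_module (hyperint U))" by (simp add: exact_relations_def)
    then obtain x where x: "v = (\<chi> j. ultra_class U (x j))" by (rule hyper_vec_cases)
    from v have "eventually (\<lambda>n. \<Theta> *v (\<chi> j. real_of_int (x j n)) = 0) U"
      by (simp add: x exact_relations_class)
    then have "eventually (\<lambda>n. \<forall>j. x j n = 0) U"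
      by (rule eventually_mono) (use ind in \<open>auto simp: columns_rat_independent_iff_int\<close>)
    then show ?thesis by (simp add: x hyper_vec_eq_zero_iff)
  qed
  with zero_in_exact_relations show "exact_relations U \<Theta> = {\<zero>\<^bsub>vec_module (hyperint U)\<^esub>}"
    by blast
next
  assume triv: "exact_relations U \<Theta> = {\<zero>\<^bsub>vec_module (hyperint U)\<^esub>}"
  show "columns_rat_independent \<Theta>"
    unfolding columns_rat_independent_iff_int
  proof (rule allI, rule impI)
    fix k :: "'s \<Rightarrow> int" assume "\<Theta> *v (\<chi> j. real_of_int (k j)) = 0"
    then have "(\<chi> j. ultra_class U (\<lambda>_. k j)) \<in> exact_relations U \<Theta>"
      by (simp add: exact_relations_class)
    then have "eventually (\<lambda>n. \<forall>j. k j = 0) U"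
      unfolding triv by (simp add: hyper_vec_eq_zero_iff)
    then show "\<forall>j. k j = 0" using assms by (simp add: eventually_const_iff)
  qed
qed

section \<open>Exact relations as the kernel of the error map\<close>

lemma homogeneous_error_iso_iff:
  "homogeneous_error U \<Theta> \<in> iso (dioph_approx_group U \<Theta>) (homogeneous_error_group U \<Theta>) \<longleftrightarrow>
    exact_relations U \<Theta> = {\<zero>\<^bsub>vec_module (hyperint U)\<^esub>}"
proof -
  interpret group_hom "dioph_approx_group U \<Theta>" "homogeneous_error_group U \<Theta>"
    "homogeneous_error U \<Theta>"
    by (intro group_hom.intro group_hom_axioms.intro homogeneous_error_hom comm_group.axioms(2)
        comm_group_dioph_approx_group comm_group_homogeneous_error_group)
  have "kernel (dioph_approx_group U \<Theta>) (homogeneous_error_group U \<Theta>) (homogeneous_error U \<Theta>) =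
      exact_relations U \<Theta>"
    using exact_relations_subset_dioph_approx[of U \<Theta>]
    by (auto simp: kernel_def dioph_approx_group_def homogeneous_error_group_def
        exact_relations_def dioph_approx_def)
  moreover have "homogeneous_error U \<Theta> ` carrier (dioph_approx_group U \<Theta>) =
      carrier (homogeneous_error_group U \<Theta>)"
    by (simp add: dioph_approx_group_def homogeneous_error_group_def homogeneous_errors_def)
  ultimately show ?thesis
    by (simp add: Group.iso_iff inj_iff_trivial_ker) (simp add: dioph_approx_group_def)
qed

section \<open>Exact relations as the largest submodule of the approximation group\<close>

lemma exact_relations_submodule:
  "submodule (exact_relations U \<Theta>) (hyperint U) (vec_module (hyperint U))"
proof -
  let ?M = "vec_module (hyperint U)"
  interpret module "hyperint U" ?M by (rule module_vec_module) (rule cring_ultrapower)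
  have sub: "exact_relations U \<Theta> \<subseteq> carrier ?M" by (auto simp: exact_relations_def)
  have smult: "a \<odot>\<^bsub>?M\<^esub> v \<in> exact_relations U \<Theta>"
    if a: "a \<in> carrier (hyperint U)" and v: "v \<in> exact_relations U \<Theta>" for a v
  proof -
    obtain m where m: "a = ultra_class U m" using a by (auto simp: carrier_ultrapower)
    obtain x where x: "v = (\<chi> j. ultra_class U (x j))"
      using v sub by (blast elim: hyper_vec_cases)
    have "(\<chi> j. real_of_int (m n * x j n)) = real_of_int (m n) *\<^sub>R (\<chi> j. real_of_int (x j n))" for n
      by (simp add: vec_eq_iff)
    with v show ?thesis
      by (auto simp: m x hyper_vec_smult exact_relations_class matrix_vector_mult_scaleR
          elim: eventually_mono)
  qed
  show ?thesis
  proof (rule submoduleI)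
    show "v \<oplus>\<^bsub>?M\<^esub> w \<in> exact_relations U \<Theta>"
      if "v \<in> exact_relations U \<Theta>" "w \<in> exact_relations U \<Theta>" for v w
      using that
      by (simp add: exact_relations_def homogeneous_error_add hyper_vec_zero hyper_vec_add)
    show "\<ominus>\<^bsub>?M\<^esub> v \<in> exact_relations U \<Theta>" if v: "v \<in> exact_relations U \<Theta>" for v
    proof -
      have "\<ominus>\<^bsub>?M\<^esub> v = (\<ominus>\<^bsub>hyperint U\<^esub> \<one>\<^bsub>hyperint U\<^esub>) \<odot>\<^bsub>?M\<^esub> v"
        using v sub by (auto simp: smult_l_minus)
      then show ?thesis using smult[OF _ v] by simp
    qed
  qed (use sub smult zero_in_exact_relations in auto)
qed

text \<open>The multiplier can be chosen separately at each index. Taken of the size of the reciprocal of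
  the term there, it brings every nonzero term to absolute value at least \<open>1\<close>.\<close>

lemma eventually_zero_if_int_multiples_tendsto_zero:
  fixes y :: "nat \<Rightarrow> real"
  assumes "\<And>m :: nat \<Rightarrow> int. ((\<lambda>n. real_of_int (m n) * y n) \<longlongrightarrow> 0) U"
  shows "eventually (\<lambda>n. y n = 0) U"
proof -
  let ?m = "\<lambda>n. \<lceil>1 / \<bar>y n\<bar>\<rceil>"
  have "eventually (\<lambda>n. \<bar>real_of_int (?m n) * y n\<bar> < 1) U"
    using tendstoD[OF assms[of ?m], of 1] by simp
  then show ?thesis
  proof (rule eventually_mono)
    fix n assume less: "\<bar>real_of_int (?m n) * y n\<bar> < 1"
    show "y n = 0"
    proof (rule ccontr)
      assume "y n \<noteq> 0"
      then have "1 = (1 / \<bar>y n\<bar>) * \<bar>y n\<bar>" by simp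
      also have "\<dots> \<le> real_of_int (?m n) * \<bar>y n\<bar>"
        by (rule mult_right_mono) simp_all
      also have "\<dots> \<le> \<bar>real_of_int (?m n) * y n\<bar>"
        by (simp add: abs_mult mult_right_mono)
      finally show False using less by simp
    qed
  qed
qed

lemma submodule_imp_exact_relations:
  fixes \<Theta> :: "real ^ 's ^ 'r"
  assumes I: "submodule I (hyperint U) (vec_module (hyperint U))" and sub: "I \<subseteq> dioph_approx U \<Theta>"
  shows "I \<subseteq> exact_relations U \<Theta>"
proof
  fix v assume v: "v \<in> I"
  with sub have "v \<in> dioph_approx U \<Theta>" by blast
  then obtain x where x: "v = (\<chi> j. ultra_class U (x j))" by (rule dioph_approx_cases)
  have mult: "((\<lambda>n. real_of_int (m n) * (\<Theta> *v (\<chi> j. real_of_int (x j n))) $ i) \<longlongrightarrow> 0) U"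
    for m and i :: 'r
  proof -
    have "ultra_class U m \<odot>\<^bsub>vec_module (hyperint U)\<^esub> v \<in> I"
      using submodule.smult_closed[OF I ultra_class_closed v] .
    with sub have "(\<chi> j. ultra_class U (\<lambda>n. m n * x j n)) \<in> dioph_approx U \<Theta>"
      by (auto simp: x hyper_vec_smult)
    then show ?thesis
      by (simp add: dioph_approx_class matrix_vector_mult_def sum_distrib_left mult.left_commute)
  qed
  have "eventually (\<lambda>n. \<forall>i. (\<Theta> *v (\<chi> j. real_of_int (x j n))) $ i = 0) U"
    by (intro eventually_all_finite eventually_zero_if_int_multiples_tendsto_zero mult)
  then show "v \<in> exact_relations U \<Theta>"
    by (simp add: x exact_relations_class vec_eq_iff)
qed

lemma no_submodule_iff:
  "\<not> (\<exists>I. submodule I (hyperint U) (vec_module (hyperint U)) \<and>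
          I \<subseteq> dioph_approx U \<Theta> \<and> I \<noteq> {\<zero>\<^bsub>vec_module (hyperint U)\<^esub>}) \<longleftrightarrow>
    exact_relations U \<Theta> = {\<zero>\<^bsub>vec_module (hyperint U)\<^esub>}"
proof
  assume triv: "exact_relations U \<Theta> = {\<zero>\<^bsub>vec_module (hyperint U)\<^esub>}"
  have "I = {\<zero>\<^bsub>vec_module (hyperint U)\<^esub>}"
    if I: "submodule I (hyperint U) (vec_module (hyperint U))" "I \<subseteq> dioph_approx U \<Theta>" for I
  proof -
    have "\<zero>\<^bsub>vec_module (hyperint U)\<^esub> \<in> I"
      using subgroup.one_closed[OF submodule.axioms(1)[OF I(1)]] by simp
    with submodule_imp_exact_relations[OF I] show ?thesis unfolding triv by blast
  qed
  then show "\<not> (\<exists>I. submodule I (hyperint U) (vec_module (hyperint U)) \<and>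
      I \<subseteq> dioph_approx U \<Theta> \<and> I \<noteq> {\<zero>\<^bsub>vec_module (hyperint U)\<^esub>})"
    by blast
qed (use exact_relations_submodule exact_relations_subset_dioph_approx in blast)

theorem theorem7:
  fixes U :: "nat filter" and \<Theta> :: "real ^ 's ^ 'r"
  assumes "nonprincipal_ultrafilter U"
  shows "(columns_rat_independent \<Theta> \<longleftrightarrow>
            homogeneous_error U \<Theta> \<in> iso (dioph_approx_group U \<Theta>) (homogeneous_error_group U \<Theta>)) \<and>
         (homogeneous_error U \<Theta> \<in> iso (dioph_approx_group U \<Theta>) (homogeneous_error_group U \<Theta>) \<longleftrightarrow>
            \<not> (\<exists>I. submodule I (hyperint U) (vec_module (hyperint U)) \<and>
                   I \<subseteq> dioph_approx U \<Theta> \<and> I \<noteq> {\<zero>\<^bsub>vec_module (hyperint U)\<^esub>}))"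
proof -
  have "U \<noteq> bot" using assms by (simp add: nonprincipal_ultrafilter_def)
  then show ?thesis
    unfolding no_submodule_iff homogeneous_error_iso_iff exact_relations_trivial_iff[OF \<open>U \<noteq> bot\<close>]
    by simp
qed

end
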